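(* Let $n\ge3$, $l\ge5$ and $0\le\alpha<1$. Let $H$ be a connected linear $3$-graph on $n$ vertices. If $H$ is Berge-$C_l$-free, then $$\rho_\alpha^2(H)\le \alpha\frac{(n-1)^2}{4}+(1-\alpha)\frac{(6l-13)(n-1)}{4}.$$
   Context: A $k$-graph ($k$-uniform hypergraph) $H$ consists of a finite vertex set $V(H)$ and a set $E(H)$ of $k$-element subsets of $V(H)$ (edges). $H$ is linear if any two distinct edges share at most one vertex. Two vertices are adjacent if some edge contains both; $H$ is connected if the graph on $V(H)$ with this adjacency relation is connected. The degree $d_v$ of a vertex $v$ is the number of edges containing $v$. For $V(H)=\{v_1,\dots,v_n\}$, the adjacency tensor $\mathcal{A}(H)=(a_{i_1\dots i_k})$ is the order-$k$, dimension-$n$ tensor with $a_{i_1\dots i_k}=\frac{1}{(k-1)!}$ if $\{v_{i_1},\dots,v_{i_k}\}\in E(H)$ and $0$ otherwise; $\mathcal{D}(H)$ is the diagonal tensor with entries $d_{i\dots i}=d_{v_i}$ and all other entries $0$. For $0\le\alpha<1$, $\mathcal{A}_\alpha(H)=\alpha\mathcal{D}(H)+(1-\alpha)\mathcal{A}(H)$. A number $\lambda\in\mathbb{C}$ is an eigenvalue of an order-$k$ dimension-$n$ tensor $\mathcal{A}=(a_{i_1\dots i_k})$ if there is a nonzero $\mathbf{x}\in\mathbb{C}^n$ with $\sum_{i_2,\dots,i_k=1}^n a_{i i_2\dots i_k}x_{i_2}\cdots x_{i_k}=\lambda x_i^{k-1}$ for all $i$; the spectral radius is the largest modulus of an eigenvalue.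 $\rho_\alpha(H)$ denotes the spectral radius of $\mathcal{A}_\alpha(H)$. For a graph $G$, a hypergraph $F$ is a Berge-$G$ if there is a bijection $\varphi:E(G)\to E(F)$ with $e\subseteq\varphi(e)$ for every $e\in E(G)$. $H$ is Berge-$G$-free if no subhypergraph of $H$ is a Berge-$G$. $C_l$ denotes the cycle of length $l$. *)

theory Defs
  imports "HOL-Analysis.Analysis"
begin

section \<open>Hypergraphs\<close>

datatype 'a hypergraph = Hypergraph (verts: "'a set") (edges: "'a set set")

definition uniform_hypergraph :: "nat \<Rightarrow> 'a hypergraph \<Rightarrow> bool" where
  "uniform_hypergraph k H \<longleftrightarrow>
     finite (verts H) \<and> (\<forall>e\<in>edges H. e \<subseteq> verts H \<and> card e = k)"

definition linear_hypergraph :: "'a hypergraph \<Rightarrow> bool" where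
  "linear_hypergraph H \<longleftrightarrow>
     (\<forall>e\<in>edges H. \<forall>f\<in>edges H. e \<noteq> f \<longrightarrow> card (e \<inter> f) \<le> 1)"

definition adjacent :: "'a hypergraph \<Rightarrow> 'a \<Rightarrow> 'a \<Rightarrow> bool" where
  "adjacent H u v \<longleftrightarrow> (\<exists>e\<in>edges H. u \<in> e \<and> v \<in> e)"

definition connected_hypergraph :: "'a hypergraph \<Rightarrow> bool" where
  "connected_hypergraph H \<longleftrightarrow>
     verts H \<noteq> {} \<and> (\<forall>u\<in>verts H. \<forall>v\<in>verts H. (adjacent H)\<^sup>*\<^sup>* u v)"

definition vertex_degree :: "'a hypergraph \<Rightarrow> 'a \<Rightarrow> nat" where
  "vertex_degree H v = card {e \<in> edges H. v \<in> e}"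

definition subhypergraph :: "'a hypergraph \<Rightarrow> 'a hypergraph \<Rightarrow> bool" where
  "subhypergraph F H \<longleftrightarrow>
     verts F \<subseteq> verts H \<and> edges F \<subseteq> edges H \<and> (\<forall>e\<in>edges F. e \<subseteq> verts F)"

text \<open>
  The graph \<open>G\<close> is only considered up to isomorphism, so the condition that each edge of \<open>G\<close> is
  contained in its image is imposed on a copy of \<open>G\<close> inside the vertex set of \<open>F\<close>, given by
  the embedding \<open>f\<close>.
\<close>

definition is_Berge :: "'b hypergraph \<Rightarrow> 'a hypergraph \<Rightarrow> bool" where
  "is_Berge G F \<longleftrightarrow>
     (\<exists>f \<phi>. inj_on f (verts G) \<and> f ` verts G \<subseteq> verts F \<and>
        bij_betw \<phi> (edges G) (edges F) \<and> (\<forall>e\<in>edges G. f ` e \<subseteq> \<phi> e))"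

definition Berge_free :: "'b hypergraph \<Rightarrow> 'a hypergraph \<Rightarrow> bool" where
  "Berge_free G H \<longleftrightarrow> (\<nexists>F. subhypergraph F H \<and> is_Berge G F)"

text \<open>This is the cycle of length \<open>l\<close> for \<open>l \<ge> 3\<close> only.\<close>

definition cycle_graph :: "nat \<Rightarrow> nat hypergraph" where
  "cycle_graph l = Hypergraph {0..<l} ((\<lambda>i. {i, Suc i mod l}) ` {0..<l})"


section \<open>Tensors and their eigenvalues\<close>

text \<open>
  A tensor of order \<open>k\<close> whose indices range over a finite set \<open>I\<close> (its dimension being
  \<open>card I\<close>) is a function on lists, relevant only on lists of length \<open>k\<close> over \<open>I\<close>.  For the
  tensors of a hypergraph, \<open>I\<close> is the vertex set itself, which avoids choosing an enumeration of
  the vertices.  Likewise only the values on \<open>I\<close> of a vector \<open>x\<close> matter.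
\<close>

type_synonym 'a tensor = "'a list \<Rightarrow> complex"

definition tensor_eigenvalue :: "nat \<Rightarrow> 'a set \<Rightarrow> 'a tensor \<Rightarrow> complex \<Rightarrow> bool" where
  "tensor_eigenvalue k I T \<mu> \<longleftrightarrow>
     (\<exists>x :: 'a \<Rightarrow> complex. (\<exists>i\<in>I. x i \<noteq> 0) \<and>
        (\<forall>i\<in>I. (\<Sum>is \<in> {is. set is \<subseteq> I \<and> length is = k - 1}.
                    T (i # is) * prod_list (map x is)) = \<mu> * x i ^ (k - 1)))"

text \<open>
  The supremum is a maximum whenever \<open>I\<close> is finite and an eigenvalue exists; see
  \<open>tensor_spectral_radius_attained\<close> below.
\<close>

definition tensor_spectral_radius :: "nat \<Rightarrow> 'a set \<Rightarrow> 'a tensor \<Rightarrow> real" where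
  "tensor_spectral_radius k I T = Sup (cmod ` {\<mu>. tensor_eigenvalue k I T \<mu>})"

definition adjacency_tensor :: "nat \<Rightarrow> 'a hypergraph \<Rightarrow> 'a tensor" where
  "adjacency_tensor k H is =
     (if length is = k \<and> set is \<in> edges H then 1 / fact (k - 1) else 0)"

definition degree_tensor :: "nat \<Rightarrow> 'a hypergraph \<Rightarrow> 'a tensor" where
  "degree_tensor k H is =
     (if \<exists>v\<in>verts H. is = replicate k v then of_nat (vertex_degree H (hd is)) else 0)"

definition A_alpha_tensor :: "real \<Rightarrow> nat \<Rightarrow> 'a hypergraph \<Rightarrow> 'a tensor" where
  "A_alpha_tensor \<alpha> k H is =
     of_real \<alpha> * degree_tensor k H is + of_real (1 - \<alpha>) * adjacency_tensor k H is"

definition rho_alpha :: "real \<Rightarrow> nat \<Rightarrow> 'a hypergraph \<Rightarrow> real" where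
  "rho_alpha \<alpha> k H = tensor_spectral_radius k (verts H) (A_alpha_tensor \<alpha> k H)"


section \<open>The spectral radius is the largest modulus of an eigenvalue\<close>

lemma tensor_eigenvalue_normalized:
  fixes T :: "'a tensor"
  assumes fin: "finite I" and ev: "tensor_eigenvalue k I T \<mu>"
  obtains m and y :: "'a \<Rightarrow> complex" where "m \<in> I" "y m = 1"
    "\<forall>i\<in>I. cmod (y i) \<le> 1" "\<forall>i. i \<notin> I \<longrightarrow> y i = 0"
    "\<forall>i\<in>I. (\<Sum>is \<in> {is. set is \<subseteq> I \<and> length is = k - 1}.
        T (i # is) * prod_list (map y is)) = \<mu> * y i ^ (k - 1)"
proof -
  from ev obtain x :: "'a \<Rightarrow> complex" and j where j: "j \<in> I" "x j \<noteq> 0" and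
    eq: "\<And>i. i \<in> I \<Longrightarrow> (\<Sum>is \<in> {is. set is \<subseteq> I \<and> length is = k - 1}.
        T (i # is) * prod_list (map x is)) = \<mu> * x i ^ (k - 1)"
    unfolding tensor_eigenvalue_def by blast
  have "Max ((\<lambda>i. cmod (x i)) ` I) \<in> (\<lambda>i. cmod (x i)) ` I"
    using fin j by (intro Max_in) auto
  then obtain m where m: "m \<in> I" "cmod (x m) = Max ((\<lambda>i. cmod (x i)) ` I)"
    by auto
  have max: "cmod (x i) \<le> cmod (x m)" if "i \<in> I" for i
    using that fin m(2) by simp
  have m0: "x m \<noteq> 0"
    using max[OF j(1)] j(2) by auto
  define y where "y i = (if i \<in> I then x i / x m else 0)" for i
  have pl: "prod_list (map y is) = prod_list (map x is) / x m ^ length is"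
    if "set is \<subseteq> I" for "is"
    using that by (induction "is") (auto simp: y_def)
  show thesis
  proof
    show "m \<in> I" by fact
    show "y m = 1" using m(1) m0 by (simp add: y_def)
    show "\<forall>i\<in>I. cmod (y i) \<le> 1"
      using max m0 by (simp add: y_def norm_divide divide_le_eq_1)
    show "\<forall>i. i \<notin> I \<longrightarrow> y i = 0"
      by (simp add: y_def)
    have "(\<Sum>is \<in> {is. set is \<subseteq> I \<and> length is = k - 1}.
        T (i # is) * prod_list (map y is)) = \<mu> * y i ^ (k - 1)" if "i \<in> I" for i
    proof -
      have "(\<Sum>is \<in> {is. set is \<subseteq> I \<and> length is = k - 1}. T (i # is) * prod_list (map y is))
          = (\<Sum>is \<in> {is. set is \<subseteq> I \<and> length is = k - 1}.
              T (i # is) * prod_list (map x is) / x m ^ (k - 1))"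
        by (rule sum.cong) (auto simp: pl)
      also have "\<dots> = \<mu> * x i ^ (k - 1) / x m ^ (k - 1)"
        by (simp only: eq[OF that] flip: sum_divide_distrib)
      finally show ?thesis
        using that by (simp add: y_def power_divide)
    qed
    then show "\<forall>i\<in>I. (\<Sum>is \<in> {is. set is \<subseteq> I \<and> length is = k - 1}.
        T (i # is) * prod_list (map y is)) = \<mu> * y i ^ (k - 1)"
      by blast
  qed
qed

lemma tensor_spectral_radius_attained:
  fixes T :: "'a tensor"
  assumes fin: "finite I" and ev: "tensor_eigenvalue k I T \<mu>"
  shows "\<exists>\<kappa>. tensor_eigenvalue k I T \<kappa> \<and> cmod \<kappa> = tensor_spectral_radius k I T"
    and "cmod \<mu> \<le> tensor_spectral_radius k I T"
proof -
  let ?L = "{is. set is \<subseteq> I \<and> length is = k - 1}"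
  define M where "M = (\<Sum>i\<in>I. \<Sum>is\<in>?L. cmod (T (i # is)))"
  define B where "B = (\<Pi>\<^sub>E i\<in>UNIV. if i \<in> I then cball (0::complex) 1 else {0})"
  define g where "g i p = (\<Sum>is\<in>?L. T (i # is) * prod_list (map (snd p) is))
     - fst p * snd p i ^ (k - 1)" for i and p :: "complex \<times> ('a \<Rightarrow> complex)"
  define S where "S = (cball 0 M \<times> B) \<inter>
    ((\<Union>m\<in>I. {p. snd p m = 1}) \<inter> (\<Inter>i\<in>I. {p. g i p = 0}))"
  have "compactin (product_topology (\<lambda>_. euclidean) UNIV) B"
    unfolding B_def compactin_PiE by auto
  then have "compact B"
    by (simp add: euclidean_product_topology)
  have cc: "continuous_on UNIV (\<lambda>p :: complex \<times> ('a \<Rightarrow> complex). snd p i)" for i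
    by (rule continuous_on_product_then_coordinatewise) (intro continuous_intros)
  have cp: "continuous_on UNIV
      (\<lambda>p :: complex \<times> ('a \<Rightarrow> complex). prod_list (map (snd p) is))" for "is"
    by (induction "is") (auto intro!: continuous_intros cc)
  have cg: "continuous_on UNIV (g i)" for i
    unfolding g_def by (intro continuous_intros cc cp)
  have "closed ((\<Union>m\<in>I. {p. snd p m = 1}) \<inter> (\<Inter>i\<in>I. {p. g i p = 0}))"
    using fin by (intro closed_Int closed_UN closed_INT ballI closed_Collect_eq cc cg
        continuous_on_const) auto
  then have "compact S"
    unfolding S_def using \<open>compact B\<close> by (intro compact_Int_closed compact_Times compact_cball)
  have fS: "fst ` S = {\<mu>. tensor_eigenvalue k I T \<mu>}"
  proof (intro set_eqI iffI)
    fix \<nu> assume "\<nu> \<in> fst ` S"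
    then obtain y m where "m \<in> I" "y m = 1" "\<And>i. i \<in> I \<Longrightarrow> g i (\<nu>, y) = 0"
      unfolding S_def by force
    then show "\<nu> \<in> {\<mu>. tensor_eigenvalue k I T \<mu>}"
      unfolding tensor_eigenvalue_def g_def by (auto intro!: exI[of _ y] bexI[of _ m])
  next
    fix \<nu> assume "\<nu> \<in> {\<mu>. tensor_eigenvalue k I T \<mu>}"
    then have "tensor_eigenvalue k I T \<nu>" by simp
    then obtain m and y :: "'a \<Rightarrow> complex" where y: "m \<in> I" "y m = 1"
      "\<forall>i\<in>I. cmod (y i) \<le> 1" "\<forall>i. i \<notin> I \<longrightarrow> y i = 0"
      "\<forall>i\<in>I. (\<Sum>is\<in>?L. T (i # is) * prod_list (map y is)) = \<nu> * y i ^ (k - 1)"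
      by (rule tensor_eigenvalue_normalized[OF fin])
    have pl: "cmod (prod_list (map y is)) \<le> 1" if "set is \<subseteq> I" for "is"
      using that
      by (induction "is") (auto simp: norm_mult intro!: mult_le_one y(3)[rule_format])
    have "cmod \<nu> = cmod (\<Sum>is\<in>?L. T (m # is) * prod_list (map y is))"
      using bspec[OF y(5) y(1)] y(2) by simp
    also have "\<dots> \<le> (\<Sum>is\<in>?L. cmod (T (m # is)))"
    proof (rule order_trans[OF norm_sum sum_mono])
      fix "is" assume "is \<in> ?L"
      then show "cmod (T (m # is) * prod_list (map y is)) \<le> cmod (T (m # is))"
        using pl[of "is"] by (simp add: norm_mult mult_left_le)
    qed
    also have "\<dots> \<le> M"
      unfolding M_def using fin y(1)
      by (intro member_le_sum[where f = "\<lambda>i. \<Sum>is\<in>?L. cmod (T (i # is))"] sum_nonneg) auto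
    finally have "(\<nu>, y) \<in> S"
      unfolding S_def B_def g_def using y by (auto simp: PiE_iff)
    then show "\<nu> \<in> fst ` S" by force
  qed
  have "compact (cmod ` {\<mu>. tensor_eigenvalue k I T \<mu>})"
    unfolding fS[symmetric] using \<open>compact S\<close>
    by (intro compact_continuous_image continuous_intros)
  moreover have ne: "cmod ` {\<mu>. tensor_eigenvalue k I T \<mu>} \<noteq> {}"
    using ev by auto
  ultimately have "tensor_spectral_radius k I T \<in> cmod ` {\<mu>. tensor_eigenvalue k I T \<mu>}"
    and bdd: "bdd_above (cmod ` {\<mu>. tensor_eigenvalue k I T \<mu>})"
    unfolding tensor_spectral_radius_def
    by (auto intro!: closed_contains_Sup compact_imp_closed
        bounded_imp_bdd_above compact_imp_bounded simp del: image_is_empty)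
  then show "\<exists>\<kappa>. tensor_eigenvalue k I T \<kappa> \<and> cmod \<kappa> = tensor_spectral_radius k I T"
    by auto
  show "cmod \<mu> \<le> tensor_spectral_radius k I T"
    unfolding tensor_spectral_radius_def using ev by (intro cSup_upper bdd) auto
qed

end

theory Submission
  imports Defs
begin

text \<open>
  Let \<open>x\<close> be an eigenvector for \<open>\<mu>\<close>, let \<open>z\<^sub>i = |x\<^sub>i|\<^sup>2\<close> and \<open>\<rho> = |\<mu>|\<close>. By AM-GM,
  \<open>\<rho> z\<^sub>i \<le> \<alpha> d\<^sub>i z\<^sub>i + (1 - \<alpha>) / 2 \<cdot> \<Sum>\<^sub>j z\<^sub>j\<close>, where \<open>j\<close> runs over the neighbours of \<open>i\<close>. This
  is a symmetric nonnegative matrix with row sums \<open>d\<^sub>i\<close>, so \<open>\<rho>\<^sup>2\<close> is at most the maximum over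
  \<open>i\<close> of \<open>\<alpha> d\<^sub>i\<^sup>2 + (1 - \<alpha>) / 2 \<cdot> \<Sum>\<^sub>j d\<^sub>j\<close>. By linearity \<open>d\<^sub>i \<le> (n - 1) / 2\<close>.

  It remains to bound the sum of the degrees over the neighbourhood \<open>N\<close> of a vertex \<open>v\<close>, i.e.
  \<open>\<Sum>\<^sub>e |e \<inter> N|\<close>. A Berge path of length \<open>l - 2\<close> that avoids the edges at \<open>v\<close> and joins two
  vertices of \<open>N\<close> lying on different edges at \<open>v\<close> closes up through \<open>v\<close> to a Berge cycle of
  length \<open>l\<close>. If the edges with \<open>|e \<inter> N| \<ge> 2\<close> have total weight more than \<open>(2 l - 3) |N|\<close>,
  such a path is found greedily inside a subset of \<open>N\<close> of large minimum degree. If there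
  are more than \<open>l |W|\<close> edges with \<open>|e \<inter> N| = 1\<close>, where \<open>W\<close> is the set of vertices outside
  \<open>N \<union> {v}\<close>, then a greedy path of length \<open>l - 4\<close> inside \<open>W\<close> is prolonged into \<open>N\<close> at both ends.
\<close>

section \<open>Extracting a subset of large minimum weighted degree\<close>

text \<open>Take a smallest \<open>T\<close> whose total weight still exceeds
  \<open>c * card T\<close>. Removing \<open>x\<close> destroys this inequality, so the edges lost
  with \<open>x\<close> weigh more than \<open>c\<close>. Only edges with
  \<open>e \<inter> S \<subseteq> T\<close> are counted, so an edge is either lost or keeps its full
  weight.\<close>

lemma dense_subset:
  fixes F :: "'a set set"
  assumes "finite F" "finite S" "c * card S < (\<Sum>e\<in>F. card (e \<inter> S))"
  obtains T where "T \<subseteq> S" "T \<noteq> {}"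
    "\<forall>x\<in>T. c < (\<Sum>e\<in>{e \<in> F. e \<inter> S \<subseteq> T \<and> x \<in> e}. card (e \<inter> T))"
proof -
  define P where "P T \<longleftrightarrow> T \<subseteq> S \<and> c * card T < (\<Sum>e\<in>{e \<in> F. e \<inter> S \<subseteq> T}. card (e \<inter> S))" for T
  have "P S"
    unfolding P_def using assms(3) by simp
  then obtain T where T: "P T" and least: "\<And>U. P U \<Longrightarrow> card T \<le> card U"
    using ex_has_least_nat[of P S card] by blast
  have TS: "T \<subseteq> S" and finT: "finite T"
    using T assms(2) finite_subset unfolding P_def by auto
  show thesis
  proof
    show "T \<subseteq> S" by fact
    show "T \<noteq> {}"
      using T unfolding P_def by auto
    show "\<forall>x\<in>T. c < (\<Sum>e\<in>{e \<in> F. e \<inter> S \<subseteq> T \<and> x \<in> e}. card (e \<inter> T))"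
    proof
      fix x assume x: "x \<in> T"
      have "\<not> P (T - {x})"
        using least[of "T - {x}"] card_Diff1_less[OF finT x] by auto
      then have le: "(\<Sum>e\<in>{e \<in> F. e \<inter> S \<subseteq> T - {x}}. card (e \<inter> S)) \<le> c * (card T - 1)"
        using TS x finT unfolding P_def by (auto simp: not_less)
      have split: "{e \<in> F. e \<inter> S \<subseteq> T} = {e \<in> F. e \<inter> S \<subseteq> T - {x}} \<union> {e \<in> F. e \<inter> S \<subseteq> T \<and> x \<in> e}"
        using x TS by auto
      have "(\<Sum>e\<in>{e \<in> F. e \<inter> S \<subseteq> T}. card (e \<inter> S))
          = (\<Sum>e\<in>{e \<in> F. e \<inter> S \<subseteq> T - {x}}. card (e \<inter> S))
            + (\<Sum>e\<in>{e \<in> F. e \<inter> S \<subseteq> T \<and> x \<in> e}. card (e \<inter> S))"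
        unfolding split using assms(1) x TS by (intro sum.union_disjoint) auto
      moreover have "(\<Sum>e\<in>{e \<in> F. e \<inter> S \<subseteq> T \<and> x \<in> e}. card (e \<inter> S))
          = (\<Sum>e\<in>{e \<in> F. e \<inter> S \<subseteq> T \<and> x \<in> e}. card (e \<inter> T))"
        using TS by (intro sum.cong refl arg_cong[of _ _ card]) auto
      moreover have "c * card T = c * (card T - 1) + c"
        using x finT by (cases "card T") auto
      ultimately show "c < (\<Sum>e\<in>{e \<in> F. e \<inter> S \<subseteq> T \<and> x \<in> e}. card (e \<inter> T))"
        using T le unfolding P_def by linarith
    qed
  qed
qed


section \<open>Berge paths and cycles\<close>

text \<open>The vertices are \<open>a 0\<close>, ..., \<open>a k\<close> and the edges
  \<open>b 0\<close>, ..., \<open>b (k - 1)\<close>. Values beyond these ranges are arbitrary, so a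
  path is prolonged by function updates.\<close>

definition Berge_path :: "'a set set \<Rightarrow> nat \<Rightarrow> (nat \<Rightarrow> 'a) \<Rightarrow> (nat \<Rightarrow> 'a set) \<Rightarrow> bool" where
  "Berge_path F k a b \<longleftrightarrow> inj_on a {..k} \<and> inj_on b {..<k} \<and>
     (\<forall>i<k. b i \<in> F \<and> a i \<in> b i \<and> a (Suc i) \<in> b i)"

lemma Berge_path_mono: "Berge_path F k a b \<Longrightarrow> F \<subseteq> G \<Longrightarrow> Berge_path G k a b"
  unfolding Berge_path_def by blast

lemma Berge_path_append:
  assumes "Berge_path F k a b" "f \<in> F" "f \<notin> b ` {..<k}" "a k \<in> f" "x \<in> f" "x \<notin> a ` {..k}"
  shows "Berge_path F (Suc k) (a(Suc k := x)) (b(k := f))"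
proof -
  have "inj_on (a(Suc k := x)) {..Suc k}"
    using assms unfolding Berge_path_def
    by (auto simp: atMost_Suc inj_on_def)
  moreover have "inj_on (b(k := f)) {..<Suc k}"
    using assms unfolding Berge_path_def
    by (auto simp: lessThan_Suc inj_on_def)
  ultimately show ?thesis
    using assms unfolding Berge_path_def by (auto simp: less_Suc_eq)
qed

lemma Berge_path_rev:
  assumes "Berge_path F k a b"
  shows "Berge_path F k (\<lambda>i. a (k - i)) (\<lambda>i. b (k - 1 - i))"
proof -
  have "inj_on (\<lambda>i. a (k - i)) {..k}"
    using assms unfolding Berge_path_def inj_on_def
    by (metis atMost_iff diff_le_self diff_diff_cancel)
  moreover have "inj_on (\<lambda>i. b (k - 1 - i)) {..<k}"
  proof (rule inj_onI)
    fix i j assume ij: "i \<in> {..<k}" "j \<in> {..<k}" "b (k - 1 - i) = b (k - 1 - j)"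
    then have "k - 1 - i = k - 1 - j"
      using assms unfolding Berge_path_def by (intro inj_onD[of b "{..<k}"]) auto
    then show "i = j" using ij by auto
  qed
  moreover have "b (k - 1 - i) \<in> F \<and> a (k - i) \<in> b (k - 1 - i) \<and> a (k - Suc i) \<in> b (k - 1 - i)"
    if "i < k" for i
  proof -
    have "k - 1 - i < k" "Suc (k - 1 - i) = k - i" "k - 1 - i = k - Suc i"
      using that by auto
    then show ?thesis
      using assms unfolding Berge_path_def by metis
  qed
  ultimately show ?thesis
    unfolding Berge_path_def by blast
qed

lemma Berge_path_card_edges: "Berge_path F k a b \<Longrightarrow> card (b ` {..<k}) = k"
  unfolding Berge_path_def by (simp add: card_image)

text \<open>With \<open>h\<close> as edge number \<open>k\<close>, the cycle edge
  \<open>{i, Suc i mod Suc k}\<close> is sent to edge number \<open>i\<close>.\<close>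

lemma Berge_path_closed_not_Berge_free:
  assumes bp: "Berge_path (edges H) k a b" and "k \<ge> 2"
    and h: "h \<in> edges H" "h \<notin> b ` {..<k}" "a k \<in> h" "a 0 \<in> h"
    and sub: "\<And>e. e \<in> edges H \<Longrightarrow> e \<subseteq> verts H"
  shows "\<not> Berge_free (cycle_graph (Suc k)) H"
proof -
  let ?l = "Suc k"
  define c where "c = b(k := h)"
  define g where "g i = {i, Suc i mod ?l}" for i
  have c_inj: "inj_on c {0..<?l}"
    using bp h(2) unfolding Berge_path_def c_def
    by (auto simp: inj_on_def less_Suc_eq)
  \<comment> \<open>Two different indices with the same cycle edge would be cyclic successors of
    each other, which is impossible on at least three vertices.\<close>
  have g_inj: "inj_on g {0..<?l}"
  proof (rule inj_onI)
    fix i j assume ij: "i \<in> {0..<?l}" "j \<in> {0..<?l}" "g i = g j"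
    show "i = j"
    proof (rule ccontr)
      assume "i \<noteq> j"
      then have "i = Suc j mod ?l \<and> j = Suc i mod ?l"
        using ij(3) unfolding g_def doubleton_eq_iff by argo
      moreover have "Suc i mod ?l = (if i = k then 0 else Suc i)" "Suc j mod ?l = (if j = k then 0 else Suc j)"
        using ij(1,2) by auto
      ultimately have "i = Suc j \<or> j = k \<and> i = 0" "j = Suc i \<or> i = k \<and> j = 0"
        by metis+
      then show False
        using \<open>k \<ge> 2\<close> by linarith
    qed
  qed
  \<comment> \<open>Recover the index of a cycle edge, then take the hyperedge with that
    index.\<close>
  define \<phi> where "\<phi> = c \<circ> inv_into {0..<?l} g"
  have ginv: "inv_into {0..<?l} g (g i) = i" if "i \<in> {0..<?l}" for i
    using g_inj that by (rule inv_into_f_f)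
  define K where "K = Hypergraph (verts H) (c ` {0..<?l})"
  have cE: "c ` {0..<?l} \<subseteq> edges H"
    using bp h(1) unfolding Berge_path_def c_def by (auto simp: less_Suc_eq)
  have "subhypergraph K H"
    unfolding subhypergraph_def K_def using cE sub by auto
  moreover have "is_Berge (cycle_graph ?l) K"
    unfolding is_Berge_def
  proof (intro exI conjI)
    show "inj_on a (verts (cycle_graph ?l))"
      using bp unfolding Berge_path_def cycle_graph_def
      by (simp add: atLeast0LessThan lessThan_Suc_atMost)
    have "a i \<in> c i" if "i < ?l" for i
      using that bp h unfolding Berge_path_def c_def by (auto simp: less_Suc_eq)
    moreover have "a (Suc i mod ?l) \<in> c i" if "i < ?l" for i
      using that bp h unfolding Berge_path_def c_def by (cases "i = k") auto
    ultimately have ac: "a ` g i \<subseteq> c i" if "i < ?l" for i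
      using that unfolding g_def by auto
    show "a ` verts (cycle_graph ?l) \<subseteq> verts K"
    proof
      fix x assume "x \<in> a ` verts (cycle_graph ?l)"
      then obtain i where i: "i < ?l" "x = a i"
        unfolding cycle_graph_def by auto
      then have "x \<in> c i" "c i \<in> edges H"
        using ac[of i] cE unfolding g_def by auto
      then show "x \<in> verts K"
        using sub unfolding K_def by auto
    qed
    have eg: "edges (cycle_graph ?l) = g ` {0..<?l}"
      unfolding cycle_graph_def g_def by simp
    show "bij_betw \<phi> (edges (cycle_graph ?l)) (edges K)"
      unfolding \<phi>_def
    proof (rule bij_betw_trans)
      show "bij_betw (inv_into {0..<?l} g) (edges (cycle_graph ?l)) {0..<?l}"
        unfolding eg using g_inj by (intro bij_betw_inv_into) (simp add: bij_betw_def)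
      show "bij_betw c {0..<?l} (edges K)"
        using c_inj by (simp add: bij_betw_def K_def)
    qed
    show "\<forall>e\<in>edges (cycle_graph ?l). a ` e \<subseteq> \<phi> e"
      unfolding eg using ac ginv by (auto simp: \<phi>_def)
  qed
  ultimately show ?thesis
    unfolding Berge_free_def by blast
qed


section \<open>Linear triple systems\<close>

locale linear_triples =
  fixes V :: "'a set" and E :: "'a set set"
  assumes fin_V: "finite V"
    and edge_subset: "e \<in> E \<Longrightarrow> e \<subseteq> V"
    and edge_card: "e \<in> E \<Longrightarrow> card e = 3"
    and edge_unique: "\<lbrakk>e \<in> E; f \<in> E; x \<in> e; x \<in> f; y \<in> e; y \<in> f; x \<noteq> y\<rbrakk> \<Longrightarrow> e = f"
begin

lemma fin_E: "finite E"
  by (rule finite_subset[of E "Pow V"]) (use fin_V edge_subset in auto)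

lemma edge_finite: "e \<in> E \<Longrightarrow> finite e"
  using edge_subset fin_V finite_subset by blast

definition deg :: "'a \<Rightarrow> nat" where
  "deg v = card {e \<in> E. v \<in> e}"

definition nbhd :: "'a \<Rightarrow> 'a set" where
  "nbhd v = {u. u \<noteq> v \<and> (\<exists>e\<in>E. u \<in> e \<and> v \<in> e)}"

lemma nbhd_sym: "u \<in> nbhd v \<longleftrightarrow> v \<in> nbhd u"
  unfolding nbhd_def by blast

lemma nbhd_subset: "nbhd v \<subseteq> V - {v}"
  unfolding nbhd_def using edge_subset by blast

lemma fin_nbhd: "finite (nbhd v)"
  using nbhd_subset fin_V by (meson finite_Diff finite_subset)

lemma edge_at_nbhd:
  assumes "x \<in> nbhd v"
  obtains h m where "h \<in> E" "h = {v, x, m}" "m \<noteq> x" "m \<noteq> v"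
proof -
  obtain h where h: "h \<in> E" "x \<in> h" "v \<in> h" "x \<noteq> v"
    using assms unfolding nbhd_def by blast
  have "card (h - {x, v}) = 1"
    using h edge_card[OF h(1)] edge_finite[OF h(1)] by (simp add: card_Diff_subset)
  then obtain m where "h - {x, v} = {m}"
    by (auto simp: card_1_singleton_iff)
  then show thesis
    using h by (intro that[of h m]) auto
qed

text \<open>By linearity edges through \<open>p\<close> meet only in \<open>p\<close>, so their
  traces on a set without \<open>p\<close> are disjoint.\<close>

lemma sum_card_inter_star:
  assumes "p \<notin> B" "finite B" "F \<subseteq> E"
  shows "(\<Sum>e\<in>{e \<in> F. p \<in> e}. card (e \<inter> B)) \<le> card B"
proof -
  have "finite F"
    using assms(3) fin_E by (rule finite_subset)
  moreover have "e \<inter> B \<inter> (f \<inter> B) = {}"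
    if "e \<in> F" "f \<in> F" "p \<in> e" "p \<in> f" "e \<noteq> f" for e f
    using edge_unique[of e f p] that assms(1,3) by blast
  ultimately have "(\<Sum>e\<in>{e \<in> F. p \<in> e}. card (e \<inter> B)) = card (\<Union>e\<in>{e \<in> F. p \<in> e}. e \<inter> B)"
    using assms(2) by (intro card_UN_disjoint[symmetric]) auto
  also have "\<dots> \<le> card B"
    using assms by (intro card_mono) auto
  finally show ?thesis .
qed

text \<open>By linearity the edges at \<open>v\<close> cut its neighbourhood into disjoint
  pairs.\<close>

lemma card_nbhd: "card (nbhd v) = 2 * deg v"
proof -
  have "card (nbhd v) = card (\<Union>e\<in>{e \<in> E. v \<in> e}. e - {v})"
    unfolding nbhd_def by (intro arg_cong[of _ _ card]) auto
  also have "\<dots> = (\<Sum>e\<in>{e \<in> E. v \<in> e}. card (e - {v}))"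
  proof (rule card_UN_disjoint)
    show "\<forall>e\<in>{e \<in> E. v \<in> e}. \<forall>f\<in>{e \<in> E. v \<in> e}. e \<noteq> f \<longrightarrow> (e - {v}) \<inter> (f - {v}) = {}"
      using edge_unique[of _ _ v] by blast
  qed (use fin_E edge_finite in auto)
  also have "\<dots> = (\<Sum>e\<in>{e \<in> E. v \<in> e}. 2)"
    using edge_card edge_finite by (intro sum.cong) auto
  finally show ?thesis
    by (simp add: deg_def)
qed

lemma deg_le:
  assumes "v \<in> V"
  shows "2 * deg v \<le> card V - 1"
  using card_mono[OF _ nbhd_subset[of v]] fin_V assms by (simp add: card_nbhd)

section \<open>Forcing Berge cycles of prescribed length\<close>

text \<open>The path grows at its end \<open>p\<close>. When the length goes from \<open>k\<close>
  to \<open>Suc k\<close>, the forbidden set \<open>B\<close> consists of \<open>m\<close> and the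
  \<open>k\<close> earlier vertices; the threshold \<open>2 * Suc k + 1\<close> is twice its maximal
  size, plus one for the last edge of the path.\<close>

lemma greedy_Berge_path:
  assumes F: "F \<subseteq> E" "\<And>e. e \<in> F \<Longrightarrow> 2 \<le> card (e \<inter> T)"
    and heavy: "\<And>x. x \<in> T \<Longrightarrow> 2 * k + 1 < (\<Sum>e\<in>{e \<in> F. x \<in> e}. card (e \<inter> T))"
    and x: "x \<in> T" "x \<noteq> m"
  shows "\<exists>a b. Berge_path F k a b \<and> a 0 = x \<and> a ` {..k} \<subseteq> T - {m}"
  using heavy
proof (induction k)
  case 0
  show ?case
    using x by (intro exI[of _ "\<lambda>_. x"]) (auto simp: Berge_path_def)
next
  case (Suc k)
  have "\<exists>a b. Berge_path F k a b \<and> a 0 = x \<and> a ` {..k} \<subseteq> T - {m}"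
  proof (rule Suc.IH)
    fix x assume "x \<in> T"
    from Suc.prems[OF this] show "2 * k + 1 < (\<Sum>e\<in>{e \<in> F. x \<in> e}. card (e \<inter> T))"
      by (rule le_less_trans[rotated]) simp
  qed
  then obtain a b where ab: "Berge_path F k a b" "a 0 = x" "a ` {..k} \<subseteq> T - {m}"
    by blast
  define p where "p = a k"
  define B where "B = insert m (a ` {..<k})"
  have finB: "finite B" and cardB: "card B \<le> Suc k"
    unfolding B_def using card_image_le[of "{..<k}" a] by (auto simp: card_insert_if)
  have "a k \<noteq> a i" if "i < k" for i
    using ab(1) that inj_onD[of a "{..k}" k i] unfolding Berge_path_def by auto
  then have pT: "p \<in> T" and pB: "p \<notin> B"
    using ab(3) unfolding p_def B_def by auto
  \<comment> \<open>An edge at \<open>p\<close> that does not prolong the path has weight at most twice the number of its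
    vertices in \<open>B\<close>, except that the last edge of the path may have weight one more; and edges at
    \<open>p\<close> are disjoint on \<open>B\<close>.\<close>
  have "\<exists>f\<in>F. p \<in> f \<and> f \<notin> b ` {..<k} \<and> (\<exists>y \<in> f \<inter> T. y \<noteq> p \<and> y \<notin> B)"
  proof (rule ccontr)
    assume none: "\<not> ?thesis"
    \<comment> \<open>For \<open>k = 0\<close> this singles out \<open>b 0\<close>, which is no edge
      of the path; that only weakens the bound.\<close>
    define c where "c e = (if e = b (k - 1) then 1 else 0 :: nat)" for e
    have bound: "card (e \<inter> T) \<le> 2 * card (e \<inter> B) + c e" if e: "e \<in> F" "p \<in> e" for e
    proof (cases "e \<in> b ` {..<k}")
      case False
      \<comment> \<open>As \<open>e\<close> has at least two vertices in \<open>T\<close>, one of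
        them is in \<open>B\<close>, and \<open>Suc t \<le> 2 * t\<close> for
        \<open>t \<ge> 1\<close>.\<close>
      then have "e \<inter> T \<subseteq> insert p (e \<inter> B)"
        using none e by blast
      then have "card (e \<inter> T) \<le> Suc (card (e \<inter> B))"
        using finB pB card_mono[of "insert p (e \<inter> B)" "e \<inter> T"] by simp
      then show ?thesis
        using F(2)[OF e(1)] by linarith
    next
      case True
      then obtain j where j: "j < k" "e = b j" by auto
      have le3: "card (e \<inter> T) \<le> 3"
        using card_mono[of e "e \<inter> T"] e F(1) edge_card[of e] edge_finite[of e] by auto
      have aj: "a j \<in> e \<inter> B" "a (Suc j) \<in> e" "a j \<noteq> a (Suc j)"
        using ab(1) j inj_on_contraD[of a "{..k}" j "Suc j"] unfolding Berge_path_def B_def by auto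
      \<comment> \<open>On the last edge only \<open>a j\<close> is known to lie in
        \<open>B\<close>, and \<open>3 = 2 * 1 + 1\<close>; any other path edge has two vertices in
        \<open>B\<close>, and \<open>3 \<le> 2 * 2\<close>.\<close>
      show ?thesis
      proof (cases "Suc j = k")
        case True
        have "card (e \<inter> B) \<ge> 1"
          using aj(1) finB card_mono[of "e \<inter> B" "{a j}"] by simp
        moreover have "c e = 1"
          unfolding c_def j(2) True[symmetric] by simp
        ultimately show ?thesis
          using le3 by linarith
      next
        case False
        then have "{a j, a (Suc j)} \<subseteq> e \<inter> B"
          using aj j unfolding B_def by auto
        then have "card (e \<inter> B) \<ge> 2"
          using aj(3) finB card_mono[of "e \<inter> B" "{a j, a (Suc j)}"] by simp
        then show ?thesis
          using le3 by linarith
      qed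
    qed
    have finF: "finite {e \<in> F. p \<in> e}"
      by (rule finite_subset[OF _ fin_E]) (use F(1) in auto)
    have "(\<Sum>e\<in>{e \<in> F. p \<in> e}. card (e \<inter> T)) \<le> (\<Sum>e\<in>{e \<in> F. p \<in> e}. 2 * card (e \<inter> B) + c e)"
      by (intro sum_mono bound) auto
    also have "\<dots> = 2 * (\<Sum>e\<in>{e \<in> F. p \<in> e}. card (e \<inter> B)) + (\<Sum>e\<in>{e \<in> F. p \<in> e}. c e)"
      by (simp add: sum.distrib sum_distrib_left)
    also have "\<dots> \<le> 2 * Suc k + 1"
    proof (intro add_mono mult_left_mono)
      show "(\<Sum>e\<in>{e \<in> F. p \<in> e}. card (e \<inter> B)) \<le> Suc k"
        using sum_card_inter_star[OF pB finB F(1)] cardB by (rule order_trans)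
      show "(\<Sum>e\<in>{e \<in> F. p \<in> e}. c e) \<le> 1"
        unfolding c_def using finF by (simp add: sum.delta)
    qed simp
    finally show False
      using Suc.prems[OF pT] by (meson leD)
  qed
  then obtain f y where f: "f \<in> F" "p \<in> f" "f \<notin> b ` {..<k}" "y \<in> f" "y \<in> T" "y \<noteq> p" "y \<notin> B"
    by blast
  have atMost_eq: "{..k} = insert k {..<k}"
    by auto
  have "y \<notin> a ` {..k}" "y \<noteq> m"
    using f unfolding B_def p_def atMost_eq by auto
  then have "Berge_path F (Suc k) (a(Suc k := y)) (b(k := f))"
    using f ab(1) unfolding p_def by (intro Berge_path_append) auto
  moreover have "(a(Suc k := y)) ` {..Suc k} \<subseteq> T - {m}"
    using ab(3) f(5) \<open>y \<noteq> m\<close> by (auto simp: atMost_Suc)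
  moreover have "(a(Suc k := y)) 0 = x"
    using ab(2) by simp
  ultimately show ?case
    by blast
qed

text \<open>The path edges miss \<open>v\<close>, so the edges joining its two ends to
  \<open>v\<close> are new, and \<open>apart\<close> makes them distinct. They are the two
  additional edges of the cycle.\<close>

lemma Berge_path_closes_through_vertex:
  assumes bp: "Berge_path {e \<in> E. v \<notin> e} k a b" and "k \<ge> 1"
    and ends: "a 0 \<in> nbhd v" "a k \<in> nbhd v"
    and apart: "\<And>h. \<lbrakk>h \<in> E; v \<in> h; a 0 \<in> h; a k \<in> h\<rbrakk> \<Longrightarrow> False"
  shows "\<not> Berge_free (cycle_graph (k + 2)) (Hypergraph V E)"
proof -
  obtain h g where h: "h \<in> E" "a 0 \<in> h" "v \<in> h" and g: "g \<in> E" "a k \<in> g" "v \<in> g"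
    using ends unfolding nbhd_def by blast
  have "a i \<noteq> v" if "i \<le> k" for i
  proof (cases "i < k")
    case True
    then show ?thesis using bp unfolding Berge_path_def by blast
  next
    case False
    then show ?thesis using that ends(2) unfolding nbhd_def by auto
  qed
  then have new: "v \<notin> a ` {..k}" by auto
  have bE: "b i \<in> E \<and> v \<notin> b i" if "i < k" for i
    using bp that unfolding Berge_path_def by blast
  have "Berge_path E (Suc k) (a(Suc k := v)) (b(k := g))"
    using bp g bE new by (intro Berge_path_append Berge_path_mono[OF bp]) auto
  moreover have "h \<noteq> g"
    using apart h g by blast
  then have "h \<notin> (b(k := g)) ` {..<Suc k}"
    using bE h by (auto simp: less_Suc_eq)
  ultimately have "\<not> Berge_free (cycle_graph (Suc (Suc k))) (Hypergraph V E)"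
    by (intro Berge_path_closed_not_Berge_free[where h = h and a = "a(Suc k := v)" and b = "b(k := g)"])
      (use h \<open>k \<ge> 1\<close> edge_subset in \<open>simp_all del: fun_upd_apply\<close>, simp_all)
  then show ?thesis by simp
qed

text \<open>The greedy path starts at \<open>x\<close> and avoids \<open>m\<close>, the third vertex of the edge through \<open>v\<close> and
  \<open>x\<close>, so that its end lies on a different edge at \<open>v\<close>.\<close>

lemma sum_heavy_edges_le:
  assumes "l \<ge> 3" and free: "Berge_free (cycle_graph l) (Hypergraph V E)"
  shows "(\<Sum>e\<in>{e \<in> E. v \<notin> e \<and> 2 \<le> card (e \<inter> nbhd v)}. card (e \<inter> nbhd v))
           \<le> (2 * l - 3) * card (nbhd v)"
proof (rule ccontr)
  let ?N = "nbhd v"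
  let ?F = "{e \<in> E. v \<notin> e \<and> 2 \<le> card (e \<inter> ?N)}"
  assume "\<not> ?thesis"
  then have less: "(2 * l - 3) * card ?N < (\<Sum>e\<in>?F. card (e \<inter> ?N))"
    by (simp only: not_le)
  have finF: "finite ?F"
    using fin_E by auto
  \<comment> \<open>The constant \<open>2 * l - 3\<close> equals \<open>2 * (l - 2) + 1\<close>, the
    threshold for a greedy path of length \<open>l - 2\<close>.\<close>
  obtain T where T: "T \<subseteq> ?N" "T \<noteq> {}"
    "\<forall>x\<in>T. 2 * l - 3 < (\<Sum>e\<in>{e \<in> ?F. e \<inter> ?N \<subseteq> T \<and> x \<in> e}. card (e \<inter> T))"
    by (rule dense_subset[OF finF fin_nbhd less])
  define F where "F = {e \<in> ?F. e \<inter> ?N \<subseteq> T}"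
  obtain x where x: "x \<in> T" using T(2) by blast
  then obtain h m where h: "h \<in> E" "h = {v, x, m}" "m \<noteq> x" "m \<noteq> v"
    using edge_at_nbhd T(1) by blast
  have "\<exists>a b. Berge_path F (l - 2) a b \<and> a 0 = x \<and> a ` {..l - 2} \<subseteq> T - {m}"
  proof (rule greedy_Berge_path)
    show "F \<subseteq> E" unfolding F_def by auto
    fix e assume "e \<in> F"
    moreover from this have "e \<inter> T = e \<inter> ?N"
      unfolding F_def using T(1) by auto
    ultimately show "2 \<le> card (e \<inter> T)"
      unfolding F_def by simp
  next
    fix y assume "y \<in> T"
    have "{e \<in> F. y \<in> e} = {e \<in> ?F. e \<inter> ?N \<subseteq> T \<and> y \<in> e}"
      unfolding F_def by auto
    moreover have "2 * (l - 2) + 1 = 2 * l - 3"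
      using assms(1) by simp
    ultimately show "2 * (l - 2) + 1 < (\<Sum>e\<in>{e \<in> F. y \<in> e}. card (e \<inter> T))"
      using T(3)[rule_format, OF \<open>y \<in> T\<close>] by simp
  qed (use x h in auto)
  then obtain a b where ab: "Berge_path F (l - 2) a b" "a 0 = x" "a ` {..l - 2} \<subseteq> T - {m}"
    by blast
  have aN: "a (l - 2) \<in> ?N" and am: "a (l - 2) \<noteq> m"
    using ab(3) T(1) by auto
  have ax: "a (l - 2) \<noteq> x"
    using ab(1,2) assms(1) inj_onD[of a "{..l - 2}" 0 "l - 2"] unfolding Berge_path_def by auto
  have "\<not> Berge_free (cycle_graph (l - 2 + 2)) (Hypergraph V E)"
  proof (rule Berge_path_closes_through_vertex)
    show "Berge_path {e \<in> E. v \<notin> e} (l - 2) a b"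
      using ab(1) by (rule Berge_path_mono) (auto simp: F_def)
    fix g assume g: "g \<in> E" "v \<in> g" "a 0 \<in> g" "a (l - 2) \<in> g"
    have "g = h"
      using edge_unique[of g h v x] g h ab(2) x T(1) nbhd_subset by blast
    then show False
      using g(4) h(2) am ax aN nbhd_subset by blast
  qed (use assms(1) ab(2) x T(1) aN in auto)
  moreover have "l - 2 + 2 = l"
    using assms(1) by simp
  ultimately show False
    using free by simp
qed

text \<open>A light edge has two vertices in \<open>?W\<close>, so too many of them give a subset
  \<open>T\<close> in which every vertex lies on more than \<open>l\<close> of them. This leaves
  room to choose both prolongations into \<open>?N\<close> with new edges and suitable ends.\<close>

lemma card_light_edges_le:
  assumes "l \<ge> 5" and free: "Berge_free (cycle_graph l) (Hypergraph V E)" and "v \<in> V"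
  shows "card {e \<in> E. v \<notin> e \<and> card (e \<inter> nbhd v) = 1} \<le> l * card (V - {v} - nbhd v)"
proof (rule ccontr)
  let ?N = "nbhd v" and ?W = "V - {v} - nbhd v"
  let ?F = "{e \<in> E. v \<notin> e \<and> card (e \<inter> ?N) = 1}"
  assume not_le: "\<not> ?thesis"
  have finF: "finite ?F"
    using fin_E by auto
  have cardW: "card (e \<inter> ?W) = 2" if "e \<in> ?F" for e
  proof -
    have "e \<inter> ?W = e - (e \<inter> ?N)"
      using that edge_subset by blast
    then show ?thesis
      using that edge_card edge_finite by (simp add: card_Diff_subset)
  qed
  have "(\<Sum>e\<in>?F. card (e \<inter> ?W)) = 2 * card ?F"
    using cardW by simp
  then have less: "2 * l * card ?W < (\<Sum>e\<in>?F. card (e \<inter> ?W))"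
    using not_le by simp
  have finW: "finite ?W"
    using fin_V by simp
  obtain T where T: "T \<subseteq> ?W" "T \<noteq> {}"
    "\<forall>x\<in>T. 2 * l < (\<Sum>e\<in>{e \<in> ?F. e \<inter> ?W \<subseteq> T \<and> x \<in> e}. card (e \<inter> T))"
    by (rule dense_subset[OF finF finW less])
  define F where "F = {e \<in> ?F. e \<inter> ?W \<subseteq> T}"
  have cardT: "card (e \<inter> T) = 2" if "e \<in> F" for e
  proof -
    have "e \<inter> T = e \<inter> ?W"
      using that T(1) unfolding F_def by auto
    then show ?thesis
      using that cardW unfolding F_def by simp
  qed
  have heavy: "2 * l < (\<Sum>e\<in>{e \<in> F. x \<in> e}. card (e \<inter> T))" if "x \<in> T" for x
  proof -
    have "{e \<in> F. x \<in> e} = {e \<in> ?F. e \<inter> ?W \<subseteq> T \<and> x \<in> e}"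
      unfolding F_def by auto
    then show ?thesis
      using T(3)[rule_format, OF that] by simp
  qed
  have deg_F: "l < card {e \<in> F. x \<in> e}" if "x \<in> T" for x
    using heavy[OF that] cardT by simp
  obtain x where x: "x \<in> T" using T(2) by blast
  \<comment> \<open>Two edges leading into \<open>?N\<close> and two edges through \<open>v\<close>
    complete the cycle of length \<open>l\<close>.\<close>
  define k where "k = l - 4"
  have "v \<notin> T" using T(1) by blast
  \<comment> \<open>The vertex to avoid is instantiated with \<open>v\<close>, which lies outside
    \<open>T\<close>.\<close>
  have "\<exists>a b. Berge_path F k a b \<and> a 0 = x \<and> a ` {..k} \<subseteq> T - {v}"
  proof (rule greedy_Berge_path)
    show "2 * k + 1 < (\<Sum>e\<in>{e \<in> F. y \<in> e}. card (e \<inter> T))" if "y \<in> T" for y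
      by (rule le_less_trans[OF _ heavy[OF that]]) (use assms(1) in \<open>simp add: k_def\<close>)
  qed (use x \<open>v \<notin> T\<close> cardT in \<open>auto simp: F_def\<close>)
  then obtain a b where ab: "Berge_path F k a b" "a ` {..k} \<subseteq> T"
    by blast
  have unused: "\<exists>f\<in>F. y \<in> f \<and> f \<notin> X" if "y \<in> T" "finite X" "card X \<le> l" for y X
  proof (rule ccontr)
    assume "\<not> ?thesis"
    then have "{e \<in> F. y \<in> e} \<subseteq> X" by blast
    then have "card {e \<in> F. y \<in> e} \<le> card X"
      using that(2) by (intro card_mono)
    then show False
      using deg_F[OF that(1)] that(3) by linarith
  qed
  have F_N: "\<exists>y. f \<inter> ?N = {y}" if "f \<in> F" for f
    using that unfolding F_def by (auto simp: card_1_singleton_iff)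
  obtain f where f: "f \<in> F" "a k \<in> f" "f \<notin> b ` {..<k}"
  proof -
    have "a k \<in> T" "card (b ` {..<k}) \<le> l"
      using ab(2) Berge_path_card_edges[OF ab(1)] by (auto simp: k_def)
    then show thesis
      using unused[of "a k" "b ` {..<k}"] that by auto
  qed
  obtain p where p: "f \<inter> ?N = {p}"
    using F_N[OF f(1)] by blast
  have pa: "p \<notin> a ` {..k}"
    using p ab(2) T(1) by blast
  \<comment> \<open>Prolong into \<open>?N\<close> at \<open>p\<close> and reverse, so that the
    other end \<open>a 0\<close> becomes the last vertex and can be prolonged in turn.\<close>
  define a1 b1 where "a1 = (\<lambda>i. (a(Suc k := p)) (Suc k - i))" and "b1 = (\<lambda>i. (b(k := f)) (Suc k - 1 - i))"
  have bp1: "Berge_path F (Suc k) a1 b1"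
    unfolding a1_def b1_def using ab(1) f p pa by (intro Berge_path_rev Berge_path_append) auto
  have a1_0: "a1 0 = p" and a1_k: "a1 (Suc k) = a 0"
    unfolding a1_def by auto
  have a1_T: "a1 i \<in> T" if "0 < i" "i \<le> Suc k" for i
    using that ab(2) unfolding a1_def by (auto simp: image_subset_iff)
  obtain h m where h: "h \<in> E" "h = {v, p, m}" "m \<noteq> p" "m \<noteq> v"
    using edge_at_nbhd[of p v] p by blast
  \<comment> \<open>Besides the \<open>Suc k\<close> used edges, exclude those joining
    \<open>a 0\<close> to \<open>p\<close> or to \<open>m\<close>. The second end \<open>q\<close>
    then avoids the edge \<open>{v, p, m}\<close>. By linearity there is at most one excluded edge
    of each kind, so \<open>card X \<le> k + 3 = l - 1\<close>.\<close>
  define X where "X = b1 ` {..<Suc k} \<union> {e \<in> F. a 0 \<in> e \<and> p \<in> e} \<union> {e \<in> F. a 0 \<in> e \<and> m \<in> e}"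
  have a0: "a 0 \<in> T" "a 0 \<noteq> p" "a 0 \<noteq> m"
  proof -
    show "a 0 \<in> T" using ab(2) by auto
    then show "a 0 \<noteq> p" using p T(1) by auto
    have "v \<in> h" "m \<in> h"
      using h(2) by simp_all
    then have "m \<in> ?N"
      using h(1,4) unfolding nbhd_def by blast
    then show "a 0 \<noteq> m" using \<open>a 0 \<in> T\<close> T(1) by auto
  qed
  have F_sub: "F \<subseteq> E" and finF': "finite F"
    using finite_subset[of F E] fin_E unfolding F_def by auto
  have le1: "card {e \<in> F. a 0 \<in> e \<and> y \<in> e} \<le> 1" if "a 0 \<noteq> y" for y
    using finF' edge_unique[of _ _ "a 0" y] F_sub that
    by (auto simp: card_le_Suc0_iff_eq subset_iff)
  have "card X \<le> card (b1 ` {..<Suc k} \<union> {e \<in> F. a 0 \<in> e \<and> p \<in> e})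
      + card {e \<in> F. a 0 \<in> e \<and> m \<in> e}"
    unfolding X_def by (rule card_Un_le)
  also have "\<dots> \<le> card (b1 ` {..<Suc k}) + card {e \<in> F. a 0 \<in> e \<and> p \<in> e}
      + card {e \<in> F. a 0 \<in> e \<and> m \<in> e}"
    by (intro add_right_mono card_Un_le)
  also have "\<dots> \<le> l"
    using Berge_path_card_edges[OF bp1] le1[OF a0(2)] le1[OF a0(3)] assms(1)
    unfolding k_def by linarith
  finally have "card X \<le> l" .
  moreover have "finite X"
    unfolding X_def using finF' by auto
  ultimately obtain g where g: "g \<in> F" "a 0 \<in> g" "g \<notin> X"
    using unused[OF a0(1)] by blast
  obtain q where q: "g \<inter> ?N = {q}"
    using F_N[OF g(1)] by blast
  have q_new: "q \<noteq> p" "q \<noteq> m"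
    using q g unfolding X_def by auto
  have "q \<noteq> a1 i" if "i \<le> Suc k" for i
    using that a1_T[of i] a1_0 q_new(1) q T(1) by (cases "i = 0") auto
  then have "q \<notin> a1 ` {..Suc k}" by auto
  then have bp2: "Berge_path F (Suc (Suc k)) (a1(Suc (Suc k) := q)) (b1(Suc k := g))"
    using bp1 g q a1_k unfolding X_def by (intro Berge_path_append) auto
  have "\<not> Berge_free (cycle_graph (Suc (Suc k) + 2)) (Hypergraph V E)"
  proof (rule Berge_path_closes_through_vertex)
    show "Berge_path {e \<in> E. v \<notin> e} (Suc (Suc k)) (a1(Suc (Suc k) := q)) (b1(Suc k := g))"
      using bp2 by (rule Berge_path_mono) (auto simp: F_def)
    fix e assume e: "e \<in> E" "v \<in> e" "(a1(Suc (Suc k) := q)) 0 \<in> e"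
      "(a1(Suc (Suc k) := q)) (Suc (Suc k)) \<in> e"
    have pq: "p \<in> e" "q \<in> e" "p \<noteq> v" "q \<noteq> v"
      using e a1_0 p q nbhd_subset[of v] by auto
    then have "e = h"
      using edge_unique[of e h v p] e(1,2) h by blast
    then show False
      using pq q_new h(2) by blast
  qed (use a1_0 p q in auto)
  moreover have "Suc (Suc k) + 2 = l"
    using assms(1) unfolding k_def by simp
  ultimately show False
    using free by simp
qed

section \<open>The degree sum over a neighbourhood\<close>

text \<open>Double counting turns the degree sum into
  \<open>\<Sum>e\<in>E. card (e \<inter> nbhd v)\<close>, which is split into edges at
  \<open>v\<close>, light edges and heavy edges. The term with 13 stands on the left to avoid
  subtraction of naturals.\<close>

lemma sum_deg_nbhd_le:
  assumes "l \<ge> 5" "Berge_free (cycle_graph l) (Hypergraph V E)" "v \<in> V"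
  shows "2 * (\<Sum>u\<in>nbhd v. deg u) + 13 * (card V - 1) \<le> 6 * l * (card V - 1)"
proof -
  let ?N = "nbhd v"
  let ?S = "{e \<in> E. v \<in> e}" and ?F1 = "{e \<in> E. v \<notin> e \<and> card (e \<inter> ?N) = 1}"
    and ?F2 = "{e \<in> E. v \<notin> e \<and> 2 \<le> card (e \<inter> ?N)}"
  have "(\<Sum>u\<in>?N. deg u) = (\<Sum>u\<in>?N. \<Sum>e\<in>E. if u \<in> e then 1 else 0)"
    unfolding deg_def using fin_E by (simp add: sum.If_cases Int_def)
  also have "\<dots> = (\<Sum>e\<in>E. \<Sum>u\<in>?N. if u \<in> e then 1 else 0)"
    by (rule sum.swap)
  also have "\<dots> = (\<Sum>e\<in>E. card (e \<inter> ?N))"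
    using fin_nbhd by (simp add: sum.If_cases Int_commute)
  also have "\<dots> = (\<Sum>e\<in>E. (if v \<in> e then card (e \<inter> ?N) else 0)
      + ((if v \<notin> e \<and> card (e \<inter> ?N) = 1 then 1 else 0)
        + (if v \<notin> e \<and> 2 \<le> card (e \<inter> ?N) then card (e \<inter> ?N) else 0)))"
    by (rule sum.cong) auto
  also have "\<dots> = (\<Sum>e\<in>?S. card (e \<inter> ?N)) + (card ?F1 + (\<Sum>e\<in>?F2. card (e \<inter> ?N)))"
    using fin_E by (simp only: sum.distrib sum.inter_filter[symmetric] card_eq_sum)
  also have "(\<Sum>e\<in>?S. card (e \<inter> ?N)) \<le> card ?N"
    using nbhd_subset[of v] fin_nbhd by (intro sum_card_inter_star) auto
  also have "card ?F1 \<le> l * card (V - {v} - ?N)"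
    using assms by (rule card_light_edges_le)
  also have "(\<Sum>e\<in>?F2. card (e \<inter> ?N)) \<le> (2 * l - 3) * card ?N"
    using assms by (intro sum_heavy_edges_le) auto
  finally have le: "(\<Sum>u\<in>?N. deg u) \<le> card ?N + (l * card (V - {v} - ?N) + (2 * l - 3) * card ?N)"
    by simp
  define A B where "A = card ?N" and "B = card (V - {v} - ?N)"
  have AB: "card V - 1 = A + B"
    unfolding A_def B_def using nbhd_subset[of v] fin_V assms(3) fin_nbhd
      card_mono[OF _ nbhd_subset[of v]] by (simp add: card_Diff_subset)
  obtain j where j: "l = j + 5"
    using assms(1) by (metis add.commute le_Suc_ex)
  \<comment> \<open>Comparing coefficients, this is \<open>4 * l + 9 \<le> 6 * l\<close> for
    \<open>A\<close> and \<open>2 * l + 13 \<le> 6 * l\<close> for \<open>B\<close>. Writing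
    \<open>l = j + 5\<close> removes the truncated subtraction.\<close>
  have "2 * (A + (l * B + (2 * l - 3) * A)) + 13 * (A + B) \<le> 6 * l * (A + B)"
    unfolding j by (simp add: algebra_simps)
  then show ?thesis
    using le unfolding AB A_def[symmetric] B_def[symmetric]
    by (meson add_right_mono mult_le_mono2 order_trans)
qed

section \<open>Bounding a nonnegative subeigenvector by degrees\<close>

text \<open>The 0-1 matrix of the neighbourhood relation is symmetric, hence self-adjoint.\<close>

lemma sum_nbhd_swap:
  fixes w z :: "'a \<Rightarrow> real"
  shows "(\<Sum>i\<in>V. w i * (\<Sum>j\<in>nbhd i. z j)) = (\<Sum>j\<in>V. z j * (\<Sum>i\<in>nbhd j. w i))"
proof -
  have expand: "(\<Sum>i\<in>V. f i * (\<Sum>j\<in>nbhd i. g j)) = (\<Sum>i\<in>V. \<Sum>j\<in>V. if j \<in> nbhd i then f i * g j else 0)"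
    for f g :: "'a \<Rightarrow> real"
  proof (rule sum.cong)
    fix i
    have "V \<inter> nbhd i = nbhd i"
      using nbhd_subset by blast
    then show "f i * (\<Sum>j\<in>nbhd i. g j) = (\<Sum>j\<in>V. if j \<in> nbhd i then f i * g j else 0)"
      using fin_V by (simp add: sum.If_cases sum_distrib_left)
  qed simp
  show ?thesis
    unfolding expand by (subst sum.swap) (intro sum.cong refl if_cong, auto simp: nbhd_sym mult.commute)
qed

text \<open>The degrees are the row sums of the matrix in \<open>sub\<close>: pairing \<open>sub\<close> with the
  constant vector and then with the vector of degrees gives two factors \<open>\<rho>\<close>.\<close>

lemma subeigenvector_bound:
  fixes z :: "'a \<Rightarrow> real" and \<alpha> \<rho> R :: real
  assumes z: "\<And>i. i \<in> V \<Longrightarrow> 0 \<le> z i" "\<exists>i\<in>V. z i \<noteq> 0" and "0 \<le> \<rho>"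
    and sub: "\<And>i. i \<in> V \<Longrightarrow> \<rho> * z i \<le> \<alpha> * deg i * z i + (1 - \<alpha>) / 2 * (\<Sum>j\<in>nbhd i. z j)"
    and R: "\<And>i. i \<in> V \<Longrightarrow> \<alpha> * (real (deg i))\<^sup>2 + (1 - \<alpha>) / 2 * (\<Sum>j\<in>nbhd i. real (deg j)) \<le> R"
  shows "\<rho>\<^sup>2 \<le> R"
proof -
  have expand: "(\<Sum>i\<in>V. f i * (\<alpha> * deg i * g i + (1 - \<alpha>) / 2 * h i))
      = (\<Sum>i\<in>V. \<alpha> * deg i * f i * g i) + (1 - \<alpha>) / 2 * (\<Sum>i\<in>V. f i * h i)"
    for f g h :: "'a \<Rightarrow> real"
    unfolding sum_distrib_left sum.distrib[symmetric]
    by (intro sum.cong refl) (simp only: distrib_left mult_ac)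
  \<comment> \<open>Pair the inequality with \<open>w\<close> and move the symmetric matrix from
    \<open>z\<close> to \<open>w\<close>.\<close>
  have paired: "\<rho> * (\<Sum>i\<in>V. w i * z i)
      \<le> (\<Sum>i\<in>V. z i * (\<alpha> * deg i * w i + (1 - \<alpha>) / 2 * (\<Sum>j\<in>nbhd i. w j)))"
    if w: "\<And>i. i \<in> V \<Longrightarrow> 0 \<le> w i" for w :: "'a \<Rightarrow> real"
  proof -
    have "\<rho> * (\<Sum>i\<in>V. w i * z i) = (\<Sum>i\<in>V. w i * (\<rho> * z i))"
      by (simp add: sum_distrib_left mult_ac)
    also have "\<dots> \<le> (\<Sum>i\<in>V. w i * (\<alpha> * deg i * z i + (1 - \<alpha>) / 2 * (\<Sum>j\<in>nbhd i. z j)))"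
      by (intro sum_mono mult_left_mono sub w)
    also have "\<dots> = (\<Sum>i\<in>V. \<alpha> * deg i * w i * z i) + (1 - \<alpha>) / 2 * (\<Sum>i\<in>V. w i * (\<Sum>j\<in>nbhd i. z j))"
      by (rule expand)
    also have "\<dots> = (\<Sum>i\<in>V. \<alpha> * deg i * z i * w i) + (1 - \<alpha>) / 2 * (\<Sum>i\<in>V. z i * (\<Sum>j\<in>nbhd i. w j))"
      by (simp only: sum_nbhd_swap[of w z] mult_ac)
    also have "\<dots> = (\<Sum>i\<in>V. z i * (\<alpha> * deg i * w i + (1 - \<alpha>) / 2 * (\<Sum>j\<in>nbhd i. w j)))"
      by (rule expand[symmetric])
    finally show ?thesis .
  qed
  have "\<alpha> * deg i + (1 - \<alpha>) / 2 * real (card (nbhd i)) = deg i" for i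
    by (simp add: card_nbhd field_simps)
  then have one: "\<rho> * (\<Sum>i\<in>V. z i) \<le> (\<Sum>i\<in>V. real (deg i) * z i)"
    using paired[of "\<lambda>_. 1"] by (simp add: mult.commute)
  have "\<rho>\<^sup>2 * (\<Sum>i\<in>V. z i) = \<rho> * (\<rho> * (\<Sum>i\<in>V. z i))"
    by (simp add: power2_eq_square)
  also have "\<dots> \<le> \<rho> * (\<Sum>i\<in>V. real (deg i) * z i)"
    using one \<open>0 \<le> \<rho>\<close> by (rule mult_left_mono)
  also have "\<dots> \<le> (\<Sum>i\<in>V. z i * (\<alpha> * deg i * deg i + (1 - \<alpha>) / 2 * (\<Sum>j\<in>nbhd i. real (deg j))))"
    by (rule paired) simp
  also have "\<dots> \<le> (\<Sum>i\<in>V. z i * R)"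
    using R by (intro sum_mono mult_left_mono z(1)) (simp add: power2_eq_square mult.assoc)
  also have "\<dots> = R * (\<Sum>i\<in>V. z i)"
    by (simp add: sum_distrib_left mult.commute)
  finally have "\<rho>\<^sup>2 * (\<Sum>i\<in>V. z i) \<le> R * (\<Sum>i\<in>V. z i)" .
  moreover have "0 < (\<Sum>i\<in>V. z i)"
    using z fin_V by (metis less_eq_real_def sum_nonneg sum_nonneg_eq_0_iff)
  ultimately show ?thesis
    by simp
qed

section \<open>Eigenvalues of the tensor\<close>

text \<open>Ordered pairs match the index lists of the tensor: an edge \<open>{i, j, k}\<close>
  occurs as \<open>(j, k)\<close> and as \<open>(k, j)\<close>.\<close>

definition link :: "'a \<Rightarrow> ('a \<times> 'a) set" where
  "link i = {p. {i, fst p, snd p} \<in> E}"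

lemma link_distinct:
  assumes "(j, k) \<in> link i"
  shows "{i, j, k} \<in> E" "i \<noteq> j" "i \<noteq> k" "j \<noteq> k" "j \<in> V" "k \<in> V"
proof -
  show e: "{i, j, k} \<in> E"
    using assms by (simp add: link_def)
  then have "card {i, j, k} = 3"
    by (rule edge_card)
  then show "i \<noteq> j" "i \<noteq> k" "j \<noteq> k"
    by (auto simp: card_insert_if split: if_splits)
  show "j \<in> V" "k \<in> V"
    using edge_subset[OF e] by auto
qed

text \<open>By linearity \<open>i\<close> and \<open>j\<close> determine the third vertex of their
  edge.\<close>

lemma bij_betw_link_nbhd: "bij_betw fst (link i) (nbhd i)"
  unfolding bij_betw_def
proof
  show "inj_on fst (link i)"
  proof (rule inj_onI)
    fix p q assume pq: "p \<in> link i" "q \<in> link i" "fst p = fst q"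
    obtain j k where p: "p = (j, k)" by (cases p)
    obtain k' where q: "q = (j, k')" using pq(3) p by (cases q) auto
    have jk: "{i, j, k} \<in> E" "i \<noteq> j" "i \<noteq> k" "j \<noteq> k" and jk': "{i, j, k'} \<in> E"
      using link_distinct pq(1,2) p q by auto
    have "{i, j, k} = {i, j, k'}"
      by (rule edge_unique[OF jk(1) jk', of i j]) (use jk(2) in auto)
    then have "k \<in> {i, j, k'}"
      by blast
    then show "p = q"
      using jk(3,4) p q by simp
  qed
  show "fst ` link i = nbhd i"
  proof
    show "fst ` link i \<subseteq> nbhd i"
    proof
      fix j assume "j \<in> fst ` link i"
      then obtain k where "(j, k) \<in> link i"
        by auto
      then have "{i, j, k} \<in> E" "j \<noteq> i"
        using link_distinct(1,2)[of j k i] by metis+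
      then show "j \<in> nbhd i"
        unfolding nbhd_def by (auto intro!: bexI[of _ "{i, j, k}"])
    qed
    show "nbhd i \<subseteq> fst ` link i"
    proof
      fix j assume "j \<in> nbhd i"
      then obtain h m where "h \<in> E" "h = {i, j, m}"
        by (rule edge_at_nbhd)
      then have "(j, m) \<in> link i"
        by (simp add: link_def)
      then show "j \<in> fst ` link i"
        by force
    qed
  qed
qed

lemma sum_link:
  fixes z :: "'a \<Rightarrow> real"
  shows "(\<Sum>p\<in>link i. z (fst p)) = (\<Sum>j\<in>nbhd i. z j)" "(\<Sum>p\<in>link i. z (snd p)) = (\<Sum>j\<in>nbhd i. z j)"
proof -
  show fst: "(\<Sum>p\<in>link i. z (fst p)) = (\<Sum>j\<in>nbhd i. z j)"
    by (rule sum.reindex_bij_betw[OF bij_betw_link_nbhd])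
  have "(\<Sum>p\<in>link i. z (snd p)) = (\<Sum>p\<in>link i. z (fst p))"
    by (rule sum.reindex_bij_witness[of _ prod.swap prod.swap])
      (auto simp: link_def insert_commute)
  then show "(\<Sum>p\<in>link i. z (snd p)) = (\<Sum>j\<in>nbhd i. z j)"
    using fst by simp
qed

text \<open>The degree tensor contributes only at the pair \<open>(i, i)\<close>, the adjacency
  tensor only on \<open>link i\<close>, with entry \<open>1 / fact 2\<close>. These supports are
  disjoint.\<close>

lemma A_alpha_tensor_apply:
  fixes x :: "'a \<Rightarrow> complex"
  assumes "i \<in> V"
  shows "(\<Sum>is \<in> {is. set is \<subseteq> V \<and> length is = 2}.
       A_alpha_tensor \<alpha> 3 (Hypergraph V E) (i # is) * prod_list (map x is))
    = of_real \<alpha> * of_nat (deg i) * x i ^ 2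
      + of_real ((1 - \<alpha>) / 2) * (\<Sum>p\<in>link i. x (fst p) * x (snd p))"
proof -
  let ?H = "Hypergraph V E"
  have lists: "{is. set is \<subseteq> V \<and> length is = 2} = (\<lambda>p. [fst p, snd p]) ` (V \<times> V)"
  proof (intro set_eqI iffI)
    fix "is" assume "is \<in> {is. set is \<subseteq> V \<and> length is = 2}"
    then obtain j k where "is = [j, k]" "j \<in> V" "k \<in> V"
      by (auto simp: length_Suc_conv numeral_2_eq_2)
    then show "is \<in> (\<lambda>p. [fst p, snd p]) ` (V \<times> V)"
      by force
  qed auto
  have inj: "inj_on (\<lambda>p. [fst p, snd p]) (V \<times> V)"
    by (auto simp: inj_on_def)
  have D: "degree_tensor 3 ?H (i # [fst p, snd p]) = (if p = (i, i) then of_nat (deg i) else 0)" for p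
    using assms by (cases p) (auto simp: degree_tensor_def numeral_3_eq_3 vertex_degree_def deg_def)
  have A: "adjacency_tensor 3 ?H (i # [fst p, snd p]) = (if p \<in> link i then 1 / 2 else 0)" for p
    by (auto simp: adjacency_tensor_def link_def)
  have sub: "link i \<subseteq> V \<times> V"
    using link_distinct(5,6) by auto
  have "(i, i) \<notin> link i"
    using link_distinct(2)[of i i i] by blast
  then have if_split: "(\<alpha>' * (if p = (i, i) then d else 0) + \<beta> * (if p \<in> link i then 1 / 2 else 0)) * (x (fst p) * x (snd p))
      = (if p = (i, i) then \<alpha>' * d * x i ^ 2 else 0) + (if p \<in> link i then \<beta> / 2 * (x (fst p) * x (snd p)) else 0)"
    for \<alpha>' \<beta> d p
    by (auto simp: power2_eq_square)
  have "(\<Sum>is \<in> {is. set is \<subseteq> V \<and> length is = 2}. A_alpha_tensor \<alpha> 3 ?H (i # is) * prod_list (map x is))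
      = (\<Sum>p\<in>V \<times> V. A_alpha_tensor \<alpha> 3 ?H (i # [fst p, snd p]) * (x (fst p) * x (snd p)))"
    unfolding lists by (subst sum.reindex[OF inj]) simp
  also have "\<dots> = (\<Sum>p\<in>V \<times> V. (if p = (i, i) then of_real \<alpha> * of_nat (deg i) * x i ^ 2 else 0)
      + (if p \<in> link i then of_real ((1 - \<alpha>) / 2) * (x (fst p) * x (snd p)) else 0))"
    unfolding A_alpha_tensor_def D A if_split by (simp only: of_real_divide of_real_numeral)
  also have "\<dots> = (\<Sum>p\<in>V \<times> V. if p = (i, i) then of_real \<alpha> * of_nat (deg i) * x i ^ 2 else 0)
      + (\<Sum>p\<in>V \<times> V. if p \<in> link i then of_real ((1 - \<alpha>) / 2) * (x (fst p) * x (snd p)) else 0)"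
    by (rule sum.distrib)
  also have "(\<Sum>p\<in>V \<times> V. if p = (i, i) then of_real \<alpha> * of_nat (deg i) * x i ^ 2 else 0)
      = of_real \<alpha> * of_nat (deg i) * x i ^ 2"
    using fin_V assms by (subst sum.delta) auto
  also have "(\<Sum>p\<in>V \<times> V. if p \<in> link i then of_real ((1 - \<alpha>) / 2) * (x (fst p) * x (snd p)) else 0)
      = (\<Sum>p\<in>link i. of_real ((1 - \<alpha>) / 2) * (x (fst p) * x (snd p)))"
    using fin_V sub by (simp add: sum.If_cases Int_absorb1)
  finally show ?thesis
    by (simp only: sum_distrib_left)
qed

text \<open>The indicator vector of \<open>v\<close> is an eigenvector, because the two entries of a
  pair in a link differ and their product vanishes. This makes the set of eigenvalues nonempty, so
  that the spectral radius is attained.\<close>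

lemma eigenvalue_exists:
  assumes "v \<in> V"
  shows "tensor_eigenvalue 3 V (A_alpha_tensor \<alpha> 3 (Hypergraph V E)) (of_real \<alpha> * of_nat (deg v))"
  unfolding tensor_eigenvalue_def
proof (intro exI conjI ballI)
  define x :: "'a \<Rightarrow> complex" where "x u = (if u = v then 1 else 0)" for u
  show "\<exists>i\<in>V. x i \<noteq> 0"
    using assms by (auto simp: x_def)
  fix i assume i: "i \<in> V"
  have "x (fst p) * x (snd p) = 0" if "p \<in> link i" for p
    using that link_distinct(4)[of "fst p" "snd p" i] by (auto simp: x_def)
  then have "(\<Sum>p\<in>link i. x (fst p) * x (snd p)) = 0"
    by (rule sum.neutral[rule_format])
  then show "(\<Sum>is \<in> {is. set is \<subseteq> V \<and> length is = 3 - 1}.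
       A_alpha_tensor \<alpha> 3 (Hypergraph V E) (i # is) * prod_list (map x is))
    = of_real \<alpha> * of_nat (deg v) * x i ^ (3 - 1)"
    using A_alpha_tensor_apply[OF i, of \<alpha> x] by (cases "i = v") (simp_all add: x_def)
qed

lemma eigenvalue_bound:
  assumes ev: "tensor_eigenvalue 3 V (A_alpha_tensor \<alpha> 3 (Hypergraph V E)) \<mu>"
    and \<alpha>: "0 \<le> \<alpha>" "\<alpha> \<le> 1"
    and R: "\<And>i. i \<in> V \<Longrightarrow> \<alpha> * (real (deg i))\<^sup>2 + (1 - \<alpha>) / 2 * (\<Sum>j\<in>nbhd i. real (deg j)) \<le> R"
  shows "(cmod \<mu>)\<^sup>2 \<le> R"
proof -
  obtain x :: "'a \<Rightarrow> complex" where x: "\<exists>i\<in>V. x i \<noteq> 0"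
    and eq: "\<And>i. i \<in> V \<Longrightarrow> (\<Sum>is \<in> {is. set is \<subseteq> V \<and> length is = 3 - 1}.
       A_alpha_tensor \<alpha> 3 (Hypergraph V E) (i # is) * prod_list (map x is)) = \<mu> * x i ^ (3 - 1)"
    using ev unfolding tensor_eigenvalue_def by blast
  \<comment> \<open>Squared moduli make the quadratic eigenvalue equation linear: AM-GM bounds each
    product by the mean of two entries of \<open>z\<close>.\<close>
  define z where "z i = (cmod (x i))\<^sup>2" for i
  show ?thesis
  proof (rule subeigenvector_bound)
    show "\<exists>i\<in>V. z i \<noteq> 0"
      using x by (simp add: z_def)
    fix i assume i: "i \<in> V"
    show "0 \<le> z i" by (simp add: z_def)
    have "cmod \<mu> * z i = cmod (\<mu> * x i ^ 2)"
      by (simp add: z_def norm_mult norm_power)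
    also have "\<mu> * x i ^ 2 = of_real \<alpha> * of_nat (deg i) * x i ^ 2
        + of_real ((1 - \<alpha>) / 2) * (\<Sum>p\<in>link i. x (fst p) * x (snd p))"
      using eq[OF i] A_alpha_tensor_apply[OF i, of \<alpha> x] by simp
    also have "cmod \<dots> \<le> cmod (of_real \<alpha> * of_nat (deg i) * x i ^ 2)
        + cmod (of_real ((1 - \<alpha>) / 2) * (\<Sum>p\<in>link i. x (fst p) * x (snd p)))"
      by (rule norm_triangle_ineq)
    also have "\<dots> = \<alpha> * deg i * z i + (1 - \<alpha>) / 2 * cmod (\<Sum>p\<in>link i. x (fst p) * x (snd p))"
      unfolding norm_mult norm_of_real norm_of_nat norm_power z_def using \<alpha> by simp
    also have "\<dots> \<le> \<alpha> * deg i * z i + (1 - \<alpha>) / 2 * (\<Sum>j\<in>nbhd i. z j)"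
    proof (intro add_left_mono mult_left_mono)
      have "cmod (\<Sum>p\<in>link i. x (fst p) * x (snd p)) \<le> (\<Sum>p\<in>link i. cmod (x (fst p)) * cmod (x (snd p)))"
        by (rule order_trans[OF norm_sum]) (simp add: norm_mult)
      also have "\<dots> \<le> (\<Sum>p\<in>link i. (z (fst p) + z (snd p)) / 2)"
      proof (rule sum_mono)
        fix p
        show "cmod (x (fst p)) * cmod (x (snd p)) \<le> (z (fst p) + z (snd p)) / 2"
          using sum_squares_bound[of "cmod (x (fst p))" "cmod (x (snd p))"] by (simp add: z_def)
      qed
      also have "\<dots> = (\<Sum>j\<in>nbhd i. z j)"
        by (simp add: add_divide_distrib sum.distrib sum_link flip: sum_divide_distrib)
      finally show "cmod (\<Sum>p\<in>link i. x (fst p) * x (snd p)) \<le> (\<Sum>j\<in>nbhd i. z j)" .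
    qed (use \<alpha> in simp)
    finally show "cmod \<mu> * z i \<le> \<alpha> * deg i * z i + (1 - \<alpha>) / 2 * (\<Sum>j\<in>nbhd i. z j)" .
  qed (use R in auto)
qed

end

section \<open>Transfer to hypergraphs and the final estimate\<close>

lemma linear_triples_hypergraph:
  assumes "uniform_hypergraph 3 H" "linear_hypergraph H"
  shows "linear_triples (verts H) (edges H)"
proof
  show "finite (verts H)" "\<And>e. e \<in> edges H \<Longrightarrow> e \<subseteq> verts H" "\<And>e. e \<in> edges H \<Longrightarrow> card e = 3"
    using assms(1) unfolding uniform_hypergraph_def by auto
  fix e f x y
  assume ef: "e \<in> edges H" "f \<in> edges H" "x \<in> e" "x \<in> f" "y \<in> e" "y \<in> f" "x \<noteq> y"
  have "finite e"
    using assms(1) ef(1) finite_subset unfolding uniform_hypergraph_def by blast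
  then have "card {x, y} \<le> card (e \<inter> f)"
    using ef by (intro card_mono) auto
  then show "e = f"
    using assms(2) ef unfolding linear_hypergraph_def by force
qed

theorem theorem3p4:
  fixes H :: "'a hypergraph" and n l :: nat and \<alpha> :: real
  assumes "n \<ge> 3" and "l \<ge> 5" and "0 \<le> \<alpha>" and "\<alpha> < 1"
    and "uniform_hypergraph 3 H" and "linear_hypergraph H" and "connected_hypergraph H"
    and "card (verts H) = n"
    and "Berge_free (cycle_graph l) H"
  shows "(rho_alpha \<alpha> 3 H)\<^sup>2
    \<le> \<alpha> * ((real n - 1)\<^sup>2 / 4) + (1 - \<alpha>) * ((6 * real l - 13) * (real n - 1) / 4)"
proof -
  interpret linear_triples "verts H" "edges H"
    using assms(5,6) by (rule linear_triples_hypergraph)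
  have H: "Hypergraph (verts H) (edges H) = H"
    by simp
  have n1: "real (card (verts H) - 1) = real n - 1"
    using assms(1,8) by simp
  \<comment> \<open>Connectedness includes nonemptiness; a vertex yields an eigenvalue, hence one
    whose modulus is the spectral radius.\<close>
  obtain v where v: "v \<in> verts H"
    using assms(7) unfolding connected_hypergraph_def by blast
  obtain \<kappa> where \<kappa>: "tensor_eigenvalue 3 (verts H) (A_alpha_tensor \<alpha> 3 H) \<kappa>"
    "cmod \<kappa> = rho_alpha \<alpha> 3 H"
    using tensor_spectral_radius_attained(1)[OF fin_V eigenvalue_exists[OF v, of \<alpha>]]
    unfolding H rho_alpha_def by blast
  have "(cmod \<kappa>)\<^sup>2
      \<le> \<alpha> * ((real n - 1)\<^sup>2 / 4) + (1 - \<alpha>) * ((6 * real l - 13) * (real n - 1) / 4)"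
  proof (rule eigenvalue_bound)
    show "tensor_eigenvalue 3 (verts H) (A_alpha_tensor \<alpha> 3 (Hypergraph (verts H) (edges H))) \<kappa>"
      using \<kappa>(1) unfolding H .
    fix i assume i: "i \<in> verts H"
    have "real (2 * deg i) \<le> real n - 1"
      using deg_le[OF i] n1 by linarith
    then have "(2 * real (deg i))\<^sup>2 \<le> (real n - 1)\<^sup>2"
      by (intro power_mono) auto
    then have d: "(real (deg i))\<^sup>2 \<le> (real n - 1)\<^sup>2 / 4"
      by (simp add: power_mult_distrib)
    have "2 * (\<Sum>j\<in>nbhd i. deg j) + 13 * (card (verts H) - 1) \<le> 6 * l * (card (verts H) - 1)"
      using assms(2,9) i by (intro sum_deg_nbhd_le) (simp_all only: H)
    then have "real (2 * (\<Sum>j\<in>nbhd i. deg j) + 13 * (card (verts H) - 1)) \<le> real (6 * l * (card (verts H) - 1))"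
      by (simp only: of_nat_le_iff)
    then have "2 * (\<Sum>j\<in>nbhd i. real (deg j)) \<le> (6 * real l - 13) * (real n - 1)"
      unfolding of_nat_add of_nat_mult n1 by (simp add: algebra_simps)
    then have "(1 - \<alpha>) * (2 * (\<Sum>j\<in>nbhd i. real (deg j))) \<le> (1 - \<alpha>) * ((6 * real l - 13) * (real n - 1))"
      using assms(4) by (intro mult_left_mono) auto
    moreover have "\<alpha> * (real (deg i))\<^sup>2 \<le> \<alpha> * ((real n - 1)\<^sup>2 / 4)"
      using d assms(3) by (rule mult_left_mono)
    ultimately show "\<alpha> * (real (deg i))\<^sup>2 + (1 - \<alpha>) / 2 * (\<Sum>j\<in>nbhd i. real (deg j))
        \<le> \<alpha> * ((real n - 1)\<^sup>2 / 4) + (1 - \<alpha>) * ((6 * real l - 13) * (real n - 1) / 4)"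
      by simp
  qed (use assms(3,4) in auto)
  then show ?thesis
    unfolding \<kappa>(2) .
qed

end
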